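(* Let $G$ be a finite simple graph with $V_G=A\cup B$, $E_G=E_{G[A]}\cup E_{G[B]}$, and $A\cap B$ a clique of $G$. Suppose there are MAT-labelings $\lambda_A,\lambda_B,\lambda_{A\cap B}$ of $G[A],G[B],G[A\cap B]$ respectively with $\lambda_A|_{E_{G[A\cap B]}}=\lambda_B|_{E_{G[A\cap B]}}=\lambda_{A\cap B}$. Define $\lambda:E_G\to\mathbb{Z}_{>0}$ by $\lambda(e)=\lambda_A(e)$ if $e\in E_{G[A]}$ and $\lambda(e)=\lambda_B(e)$ if $e\in E_{G[B]}$. Then $\lambda$ is an MAT-labeling of $G$.
   Context: For a simple graph $H$ and $\lambda:E_H\to\mathbb{Z}_{>0}$ put $\pi_k=\lambda^{-1}(k)$, $E_k=\pi_1\sqcup\dots\sqcup\pi_k$, $E_0=\varnothing$; $\operatorname{cl}(F)$ is the set of edges whose endvertices are joined by a path of edges in $F$; $\lambda$ is an MAT-labeling of $H$ if for all $k\ge1$: (ML1) $\pi_k$ is a forest; (ML2) $\operatorname{cl}(\pi_k)\cap E_{k-1}=\varnothing$; (ML3) each $\{u,u'\}\in\pi_k$ has exactly $k-1$ vertices $w$ with $\{u,w\},\{u',w\}\in E_{k-1}$. $G[X]$ denotes the induced subgraph on $X$; $\lambda$ is well defined since the two labelings agree on $E_{G[A]}\cap E_{G[B]}=E_{G[A\cap B]}$. *)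

theory Defs
  imports Main "HOL-Library.Ramsey"
begin

text \<open>A graph is a pair of a vertex set and a set of edges, an edge being the set of its two
  endvertices.\<close>

type_synonym 'a graph = "'a set \<times> 'a set set"

abbreviation verts :: "'a graph \<Rightarrow> 'a set" where
  "verts G \<equiv> fst G"

abbreviation edges :: "'a graph \<Rightarrow> 'a set set" where
  "edges G \<equiv> snd G"

definition finite_simple_graph :: "'a graph \<Rightarrow> bool" where
  "finite_simple_graph G \<longleftrightarrow> finite (verts G) \<and> (\<forall>e\<in>edges G. e \<subseteq> verts G \<and> card e = 2)"

definition induced_subgraph :: "'a graph \<Rightarrow> 'a set \<Rightarrow> 'a graph" where
  "induced_subgraph G X = (X, {e \<in> edges G. e \<subseteq> X})"

text \<open>Paths and cycles using edges from a given set \<open>F\<close>, as lists of pairwise distinct vertices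
  (the first vertex of a cycle is not repeated at the end).\<close>

definition is_path :: "'a set set \<Rightarrow> 'a list \<Rightarrow> bool" where
  "is_path F vs \<longleftrightarrow> vs \<noteq> [] \<and> distinct vs \<and> successively (\<lambda>x y. {x, y} \<in> F) vs"

definition is_cycle :: "'a set set \<Rightarrow> 'a list \<Rightarrow> bool" where
  "is_cycle F vs \<longleftrightarrow> length vs \<ge> 3 \<and> is_path F vs \<and> {last vs, hd vs} \<in> F"

definition is_forest :: "'a set set \<Rightarrow> bool" where
  "is_forest F \<longleftrightarrow> (\<nexists>vs. is_cycle F vs)"

definition edge_closure :: "'a graph \<Rightarrow> 'a set set \<Rightarrow> 'a set set" where
  "edge_closure H F =
     {e \<in> edges H. \<exists>u v vs. e = {u, v} \<and> is_path F vs \<and> hd vs = u \<and> last vs = v}"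

definition label_class :: "'a graph \<Rightarrow> ('a set \<Rightarrow> nat) \<Rightarrow> nat \<Rightarrow> 'a set set" where
  "label_class H lam k = {e \<in> edges H. lam e = k}"

definition label_upto :: "'a graph \<Rightarrow> ('a set \<Rightarrow> nat) \<Rightarrow> nat \<Rightarrow> 'a set set" where
  "label_upto H lam k = (\<Union>i\<in>{1..k}. label_class H lam i)"

text \<open>A labeling is a total function on vertex sets of which only the values on the edges matter.\<close>

definition MAT_labeling :: "'a graph \<Rightarrow> ('a set \<Rightarrow> nat) \<Rightarrow> bool" where
  "MAT_labeling H lam \<longleftrightarrow>
     (\<forall>e\<in>edges H. lam e > 0) \<and>
     (\<forall>k\<ge>1.
        is_forest (label_class H lam k) \<and>
        edge_closure H (label_class H lam k) \<inter> label_upto H lam (k - 1) = {} \<and>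
        (\<forall>u u'. {u, u'} \<in> label_class H lam k \<longrightarrow>
           card {w \<in> verts H. {u, w} \<in> label_upto H lam (k - 1) \<and>
                              {u', w} \<in> label_upto H lam (k - 1)} = k - 1))"

end

theory Submission
  imports Defs
begin

text \<open>Write \<open>C = A \<inter> B\<close>. The point is that two vertices of \<open>C\<close> joined by a \<open>\<pi>\<^sub>k\<close>-path in \<open>A\<close> (or in \<open>B\<close>)
  are already joined by a \<open>\<pi>\<^sub>k\<close>-path in \<open>C\<close>; then a cycle or a forbidden path in \<open>G\<close> can be rerouted
  into \<open>A\<close> or \<open>B\<close>. For a MAT-labeling each \<open>E\<^sub>k\<close> is chordal, by induction on \<open>k\<close>, so the ends of an
  edge of label \<open>k\<close> have a clique of \<open>k - 1\<close> common neighbours in \<open>E\<^bsub>k-1\<^esub>\<close>, and \<open>E\<^bsub>k-1\<^esub>\<close> contains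
  a \<open>k\<close>-clique. By (ML2) its vertices lie in distinct components of the forest \<open>\<pi>\<^sub>k\<close>, which gives
  \<open>|\<pi>\<^sub>k| \<le> |C| - k\<close> in \<open>C\<close>. Summing over \<open>k\<close> yields all edges of the complete graph on \<open>C\<close>, so equality
  holds and \<open>\<pi>\<^sub>k\<close> has exactly \<open>k\<close> components on \<open>C\<close>. By (ML2) in \<open>A\<close>, the \<open>k\<close>-clique still meets \<open>k\<close>
  different components of \<open>\<pi>\<^sub>k\<close> there, so no two components merge.\<close>

section \<open>Connectedness and forests\<close>

text \<open>Walks replace the repetition-free lists of \<open>is_path\<close> to permit induction
  along a walk; \<open>conn_imp_is_path\<close> leads back to paths.\<close>

definition conn :: "'a set set \<Rightarrow> 'a \<Rightarrow> 'a \<Rightarrow> bool" where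
  "conn F = (\<lambda>x y. {x, y} \<in> F)\<^sup>*\<^sup>*"

lemma conn_refl [simp]: "conn F x x"
  by (simp add: conn_def)

lemma conn_edge: "{x, y} \<in> F \<Longrightarrow> conn F x y"
  by (simp add: conn_def r_into_rtranclp)

lemma conn_trans: "conn F x y \<Longrightarrow> conn F y z \<Longrightarrow> conn F x z"
  by (simp add: conn_def)

lemma conn_sym: "conn F x y \<Longrightarrow> conn F y x"
  unfolding conn_def by (rule sympD[OF symp_rtranclp]) (auto simp: symp_def insert_commute)

lemma conn_mono: "conn F x y \<Longrightarrow> F \<subseteq> F' \<Longrightarrow> conn F' x y"
  unfolding conn_def by (rule rtranclp_mono[THEN predicate2D, rotated]) blast+

lemma conn_induct [consumes 1, case_names refl step]:
  assumes "conn F x y" "P x"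
    and "\<And>y z. conn F x y \<Longrightarrow> P y \<Longrightarrow> {y, z} \<in> F \<Longrightarrow> P z"
  shows "P y"
  using assms unfolding conn_def by (rule rtranclp_induct)

lemma is_path_imp_conn:
  assumes "is_path F vs"
  shows "conn F (hd vs) (last vs)"
proof -
  have "vs \<noteq> [] \<Longrightarrow> successively (\<lambda>x y. {x, y} \<in> F) vs \<Longrightarrow> conn F (hd vs) (last vs)"
  proof (induction vs)
    case (Cons a vs)
    then show ?case
      by (cases vs) (auto intro: conn_trans conn_edge)
  qed simp
  then show ?thesis
    using assms by (simp add: is_path_def)
qed

lemma conn_imp_is_path:
  assumes "conn F x y"
  obtains vs where "is_path F vs" "hd vs = x" "last vs = y"
proof -
  from assms have "\<exists>vs. is_path F vs \<and> hd vs = x \<and> last vs = y"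
  proof (induction rule: conn_induct)
    case refl
    show ?case
      by (rule exI[of _ "[x]"]) (simp add: is_path_def)
  next
    case (step y z)
    then obtain vs where vs: "is_path F vs" "hd vs = x" "last vs = y"
      by blast
    show ?case
    proof (cases "z \<in> set vs")
      case True
      then obtain ys zs where "vs = ys @ z # zs"
        by (meson split_list)
      then have "is_path F (ys @ [z]) \<and> hd (ys @ [z]) = x \<and> last (ys @ [z]) = z"
        using vs successively_append_iff[of _ "ys @ [z]" zs]
        by (cases ys) (auto simp: is_path_def)
      then show ?thesis
        by blast
    next
      case False
      then have "is_path F (vs @ [z]) \<and> hd (vs @ [z]) = x \<and> last (vs @ [z]) = z"
        using vs step by (auto simp: is_path_def successively_append_iff)
      then show ?thesis
        by blast
    qed
  qed
  then show ?thesis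
    using that by blast
qed

lemma edge_closure_iff:
  "e \<in> edge_closure H F \<longleftrightarrow> e \<in> edges H \<and> (\<exists>u v. e = {u, v} \<and> conn F u v)"
proof -
  have "conn F u v \<longleftrightarrow> (\<exists>vs. is_path F vs \<and> hd vs = u \<and> last vs = v)" for u v
    by (metis is_path_imp_conn conn_imp_is_path)
  then show ?thesis
    by (simp add: edge_closure_def)
qed

text \<open>A cycle amounts to an edge and a path between its ends that avoids it. In this form
  \<open>conn\<close> alone suffices for forests.\<close>

lemma is_forest_iff:
  "is_forest F \<longleftrightarrow> (\<forall>u v. {u, v} \<in> F \<longrightarrow> u \<noteq> v \<longrightarrow> \<not> conn (F - {{u, v}}) u v)"
proof (intro iffI allI impI notI)
  fix u v
  assume "is_forest F" and uv: "{u, v} \<in> F" "u \<noteq> v" and "conn (F - {{u, v}}) u v"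
  then obtain vs where vs: "is_path (F - {{u, v}}) vs" "hd vs = u" "last vs = v"
    by (meson conn_imp_is_path)
  then have "length vs \<ge> 3"
    using uv by (cases vs; cases "tl vs"; cases "tl (tl vs)") (auto simp: is_path_def)
  moreover have "is_path F vs"
    using vs unfolding is_path_def by (auto elim: successively_mono)
  ultimately have "is_cycle F vs"
    using vs uv by (simp add: is_cycle_def insert_commute)
  then show False
    using \<open>is_forest F\<close> by (auto simp: is_forest_def)
next
  assume F: "\<forall>u v. {u, v} \<in> F \<longrightarrow> u \<noteq> v \<longrightarrow> \<not> conn (F - {{u, v}}) u v"
  show "is_forest F"
    unfolding is_forest_def
  proof
    assume "\<exists>vs. is_cycle F vs"
    then obtain vs where vs: "length vs \<ge> 3" "is_path F vs" "{last vs, hd vs} \<in> F"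
      by (auto simp: is_cycle_def)
    let ?n = "length vs"
    have ends: "hd vs = vs ! 0" "last vs = vs ! (?n - 1)"
      using vs(1) by (auto simp: hd_conv_nth last_conv_nth simp flip: length_0_conv)
    have dist: "distinct vs" and succ: "\<And>i. Suc i < ?n \<Longrightarrow> {vs ! i, vs ! Suc i} \<in> F"
      using vs by (auto simp: is_path_def successively_conv_nth)
    have inj: "vs ! i = vs ! j \<longleftrightarrow> i = j" if "i < ?n" "j < ?n" for i j
      using that dist nth_eq_iff_index_eq by blast
    \<comment> \<open>By distinctness and length at least 3, the closing edge differs from all edges
      between consecutive vertices.\<close>
    have "{vs ! i, vs ! Suc i} \<noteq> {last vs, hd vs}" if "Suc i < ?n" for i
    proof -
      have "i = ?n - 1 \<and> Suc i = 0 \<or> i = 0 \<and> Suc i = ?n - 1"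
        if "{vs ! i, vs ! Suc i} = {last vs, hd vs}"
        using that \<open>Suc i < ?n\<close> inj[of i "?n - 1"]
          inj[of "Suc i" 0] inj[of i 0] inj[of "Suc i" "?n - 1"]
        unfolding ends doubleton_eq_iff by linarith
      then show ?thesis
        using vs(1) by linarith
    qed
    then have "successively (\<lambda>x y. {x, y} \<in> F - {{last vs, hd vs}}) vs"
      using succ by (auto simp: successively_conv_nth)
    then have "is_path (F - {{last vs, hd vs}}) vs"
      using vs by (simp add: is_path_def)
    then have "conn (F - {{last vs, hd vs}}) (last vs) (hd vs)"
      by (rule is_path_imp_conn[THEN conn_sym])
    moreover have "last vs \<noteq> hd vs"
      unfolding ends using inj[of "?n - 1" 0] vs(1) by linarith
    ultimately show False
      using F vs(3) by blast
  qed
qed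

text \<open>Cut the walk at its first and last crossing of \<open>{u, v}\<close>. If it arrives at
  and departs from the same end, everything between can be skipped; otherwise the two ends
  differ.\<close>

lemma conn_delete_edge:
  assumes "conn F x y"
  shows "conn (F - {{u, v}}) x y
    \<or> conn (F - {{u, v}}) x u \<and> conn (F - {{u, v}}) v y
    \<or> conn (F - {{u, v}}) x v \<and> conn (F - {{u, v}}) u y"
  using assms
proof (induction rule: conn_induct)
  case (step y z)
  let ?F = "F - {{u, v}}"
  show ?case
  proof (cases "{y, z} = {u, v}")
    case True
    then have "y = u \<and> z = v \<or> y = v \<and> z = u"
      by (auto simp: doubleton_eq_iff)
    then show ?thesis
      using step.IH by auto
  next
    case False
    then have "conn ?F y z"
      using step by (auto intro: conn_edge)
    then show ?thesis
      using step.IH by (blast intro: conn_trans)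
  qed
qed simp

text \<open>A forest leaves \<open>card V - card F\<close> components, and \<open>Q\<close> has at
  most one vertex in each. In the induction, removing an edge splits a component, so
  \<open>Q\<close> can grow by one vertex.\<close>

lemma forest_card_le:
  assumes "finite V" "finite F" "is_forest F" "\<forall>e\<in>F. e \<subseteq> V \<and> card e = 2"
    and "Q \<subseteq> V" "\<forall>p\<in>Q. \<forall>q\<in>Q. p \<noteq> q \<longrightarrow> \<not> conn F p q"
  shows "card F + card Q \<le> card V"
  using assms(2-)
proof (induction F arbitrary: Q rule: finite_induct)
  case empty
  then show ?case
    using \<open>finite V\<close> by (simp add: card_mono)
next
  case (insert e F)
  obtain u v where e: "e = {u, v}" "u \<noteq> v"
    using insert.prems(2) by (meson card_2_iff insertI1)
  have sub: "u \<in> V" "v \<in> V"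
    using insert.prems(2) e by auto
  have eF: "insert e F - {{u, v}} = F"
    using insert.hyps e by auto
  have nuv: "\<not> conn F u v"
    using insert.prems(1) e eF unfolding is_forest_iff by (metis insertI1)
  have forest: "is_forest F"
    unfolding is_forest_iff
  proof (intro allI impI notI)
    fix a b
    assume "{a, b} \<in> F" "a \<noteq> b" "conn (F - {{a, b}}) a b"
    then show False
      using insert.prems(1) unfolding is_forest_iff
      by (meson conn_mono Diff_mono insertI2 order_refl subset_insertI)
  qed
  have mono: "conn (insert e F) p q" if "conn F p q" for p q
    using that by (rule conn_mono) auto
  have edge: "conn (insert e F) u v"
    using e by (auto intro: conn_edge)
  \<comment> \<open>One of \<open>u\<close>, \<open>v\<close> works: if both were joined to
    \<open>Q\<close>, the edge \<open>e\<close> would force the same vertex of \<open>Q\<close> for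
    both, and that vertex would join \<open>u\<close> to \<open>v\<close> in
    \<open>F\<close>.\<close>
  have "\<exists>z\<in>V. \<forall>q\<in>Q. \<not> conn F q z"
  proof (rule ccontr)
    assume "\<not> ?thesis"
    then obtain p q where pq: "p \<in> Q" "conn F p u" "q \<in> Q" "conn F q v"
      using sub by blast
    then have "conn (insert e F) p q"
      using mono edge by (meson conn_sym conn_trans)
    then have "p = q"
      using insert.prems(4) pq by blast
    then show False
      using pq nuv conn_sym conn_trans by metis
  qed
  then obtain z where z: "z \<in> V" "\<forall>q\<in>Q. \<not> conn F q z"
    by blast
  have "z \<notin> Q"
    using z by auto
  have "\<forall>p\<in>insert z Q. \<forall>q\<in>insert z Q. p \<noteq> q \<longrightarrow> \<not> conn F p q"
    using z insert.prems(4) mono conn_sym by (metis insert_iff)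
  then have "card F + card (insert z Q) \<le> card V"
    using insert.prems z forest by (intro insert.IH) auto
  moreover have "finite Q"
    using insert.prems \<open>finite V\<close> finite_subset by blast
  ultimately show ?case
    using \<open>z \<notin> Q\<close> insert.hyps by simp
qed

text \<open>Stretches of the walk along \<open>RB\<close> start and end in
  \<open>A \<inter> B\<close>, so \<open>meet\<close> replaces each by a walk in
  \<open>RA\<close>.\<close>

lemma conn_glue:
  assumes RA: "\<forall>e\<in>RA. e \<subseteq> A" and RB: "\<forall>e\<in>RB. e \<subseteq> B"
    and meet: "\<And>x y. x \<in> A \<inter> B \<Longrightarrow> y \<in> A \<inter> B \<Longrightarrow> conn RB x y \<Longrightarrow> conn RA x y"
    and "conn (RA \<union> RB) u v" "u \<in> A" "v \<in> A"
  shows "conn RA u v"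
proof -
  \<comment> \<open>Invariant: \<open>c\<close> is the current vertex, or the one where the current
    stretch along \<open>RB\<close> began.\<close>
  have "\<exists>c\<in>A. conn RA u c \<and> (c = v \<or> c \<in> B \<and> v \<in> B \<and> conn RB c v)"
    using assms(4)
  proof (induction rule: conn_induct)
    case refl
    show ?case
      by (rule bexI[of _ u]) (use \<open>u \<in> A\<close> in simp_all)
  next
    case (step y z)
    then obtain c where c: "c \<in> A" "conn RA u c" "c = y \<or> c \<in> B \<and> y \<in> B \<and> conn RB c y"
      by blast
    show ?case
    proof (cases "{y, z} \<in> RA")
      case True
      then have "y \<in> A" "z \<in> A"
        using RA by auto
      then have "conn RA u y"
        using c meet conn_trans by (metis IntI)
      then show ?thesis
        using True \<open>z \<in> A\<close> conn_edge conn_trans by metis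
    next
      case False
      then have yz: "{y, z} \<in> RB"
        using step by auto
      then have "c \<in> B" "z \<in> B"
        using c RB by auto
      moreover have "conn RB c z"
        using c(3) yz conn_edge conn_trans by metis
      ultimately show ?thesis
        using c by blast
    qed
  qed
  then show ?thesis
    using meet \<open>v \<in> A\<close> conn_trans by (metis IntI)
qed

section \<open>Chordal graphs\<close>

definition chordless_cycle :: "'a set set \<Rightarrow> nat \<Rightarrow> (nat \<Rightarrow> 'a) \<Rightarrow> bool" where
  "chordless_cycle E n f \<longleftrightarrow> n \<ge> 4 \<and> inj_on f {..<n} \<and>
     (\<forall>i<n. \<forall>j<n. {f i, f j} \<in> E \<longleftrightarrow> j = Suc i mod n \<or> i = Suc j mod n)"

definition chordal :: "'a set set \<Rightarrow> bool" where
  "chordal E \<longleftrightarrow> (\<nexists>n f. chordless_cycle E n f)"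

lemma chordless_cycleI:
  assumes "n \<ge> 4" "inj_on f {..<n}" "\<forall>e\<in>E. card e = 2"
    and "\<And>i j. i < j \<Longrightarrow> j < n \<Longrightarrow> {f i, f j} \<in> E \<longleftrightarrow> j = Suc i \<or> i = 0 \<and> Suc j = n"
  shows "chordless_cycle E n f"
  unfolding chordless_cycle_def
proof (intro conjI allI impI)
  fix i j assume ij: "i < n" "j < n"
  consider "i = j" | "i < j" | "j < i"
    by linarith
  then show "{f i, f j} \<in> E \<longleftrightarrow> j = Suc i mod n \<or> i = Suc j mod n"
  proof cases
    case 1
    then show ?thesis
      using assms(1,3) ij by (auto simp: mod_Suc)
  next
    case 2
    then show ?thesis
      using assms(1) assms(4)[OF 2] ij by (auto simp: mod_Suc)
  next
    case 3
    then show ?thesis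
      using assms(1) assms(4)[OF 3] ij by (auto simp: mod_Suc insert_commute)
  qed
qed (use assms in auto)

lemma chordless_cycle_rotate1:
  assumes "chordless_cycle E n f"
  shows "chordless_cycle E n (\<lambda>i. f (Suc i mod n))"
proof -
  have n: "n \<ge> 4"
    using assms by (simp add: chordless_cycle_def)
  have "inj_on f {..<n}"
    using assms by (simp add: chordless_cycle_def)
  moreover have "inj_on (\<lambda>i. Suc i mod n) {..<n}"
    using n by (auto simp: inj_on_def mod_Suc split: if_splits)
  moreover have "(\<lambda>i. Suc i mod n) ` {..<n} \<subseteq> {..<n}"
    using n by auto
  ultimately have "inj_on (f \<circ> (\<lambda>i. Suc i mod n)) {..<n}"
    by (meson comp_inj_on inj_on_subset)
  moreover have "{f (Suc i mod n), f (Suc j mod n)} \<in> E \<longleftrightarrow> j = Suc i mod n \<or> i = Suc j mod n"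
    if "i < n" "j < n" for i j
  proof -
    have "{f (Suc i mod n), f (Suc j mod n)} \<in> E \<longleftrightarrow>
        Suc j mod n = Suc (Suc i mod n) mod n \<or> Suc i mod n = Suc (Suc j mod n) mod n"
      using assms n by (simp add: chordless_cycle_def)
    also have "\<dots> \<longleftrightarrow> j = Suc i mod n \<or> i = Suc j mod n"
      using that n by (auto simp: mod_Suc split: if_splits)
    finally show ?thesis .
  qed
  ultimately show ?thesis
    using n by (simp add: chordless_cycle_def o_def)
qed

lemma chordless_cycle_rotate:
  assumes "chordless_cycle E n f"
  shows "chordless_cycle E n (\<lambda>i. f ((i + s) mod n))"
proof (induction s)
  case 0
  have "chordless_cycle E n (\<lambda>i. f (i mod n)) = chordless_cycle E n f"
    unfolding chordless_cycle_def by (intro conj_cong inj_on_cong refl) auto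
  then show ?case
    using assms by simp
next
  case (Suc s)
  from chordless_cycle_rotate1[OF this] show ?case
    by (simp add: mod_add_left_eq)
qed

text \<open>A shortest path from \<open>a\<close> to \<open>b\<close> is induced, so chordality makes every vertex of \<open>D\<close> adjacent
  to its second vertex.\<close>

lemma chordal_common_neighbour:
  assumes "chordal E" and E2: "\<forall>e\<in>E. card e = 2"
    and conn: "conn {e \<in> E. e \<inter> D = {}} a b" and "a \<noteq> b" and "a \<notin> D"
    and a: "\<forall>d\<in>D. {a, d} \<in> E" and b: "\<forall>d\<in>D. {b, d} \<in> E"
  obtains p where "p \<notin> D" "{a, p} \<in> E" "\<forall>d\<in>D. {p, d} \<in> E"
proof -
  let ?E = "{e \<in> E. e \<inter> D = {}}"
  define W where
    "W n f \<longleftrightarrow> f 0 = a \<and> f n = b \<and> (\<forall>i<n. {f i, f (Suc i)} \<in> ?E)" for n and f :: "nat \<Rightarrow> 'a"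
  have "\<exists>n f. f 0 = a \<and> f n = b \<and> (\<forall>i<n. {f i, f (Suc i)} \<in> ?E)"
    using conn
  proof (induction rule: conn_induct)
    case refl
    show ?case
      by (intro exI[of _ 0] exI[of _ "\<lambda>_. a"]) simp
  next
    case (step y z)
    then obtain n and f :: "nat \<Rightarrow> 'a"
      where f: "f 0 = a" "f n = y" "\<forall>i<n. {f i, f (Suc i)} \<in> ?E"
      by blast
    show ?case
      by (rule exI[of _ "Suc n"], rule exI[of _ "f(Suc n := z)"])
        (use f step in \<open>auto simp: less_Suc_eq\<close>)
  qed
  then have "\<exists>n f. W n f"
    by (simp add: W_def)
  \<comment> \<open>A walk with the fewest steps; every shortcut below contradicts
    \<open>least\<close>.\<close>
  then obtain n where n: "\<exists>f. W n f" and least: "\<And>m f. m < n \<Longrightarrow> \<not> W m f"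
    using exists_least_iff[of "\<lambda>n. \<exists>f. W n f"] by blast
  then obtain f where f: "f 0 = a" "f n = b" "\<And>i. i < n \<Longrightarrow> {f i, f (Suc i)} \<in> ?E"
    by (auto simp: W_def)
  have notD: "f i \<notin> D" if "i \<le> n" for i
    using that f(1) f(3)[of "i - 1"] \<open>a \<notin> D\<close> by (cases i) auto
  have dist: "f i \<noteq> f j" if "i < j" "j \<le> n" for i j
  proof
    assume eq: "f i = f j"
    have "W (n - (j - i)) (\<lambda>t. if t \<le> i then f t else f (t + (j - i)))"
      unfolding W_def
    proof (intro conjI allI impI)
      show "(if n - (j - i) \<le> i then f (n - (j - i)) else f (n - (j - i) + (j - i))) = b"
        using that eq f(2) by (cases "j = n") auto
      fix t assume "t < n - (j - i)"
      then show "{if t \<le> i then f t else f (t + (j - i)),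
          if Suc t \<le> i then f (Suc t) else f (Suc t + (j - i))} \<in> ?E"
        using f(3)[of t] f(3)[of "t + (j - i)"] that eq
        by (cases "t = i") (auto simp: not_less_eq_eq)
    qed (use f in auto)
    then show False
      using least[of "n - (j - i)"] that by auto
  qed
  have induced: "{f i, f j} \<notin> E" if "Suc i < j" "j \<le> n" for i j
  proof
    assume eq: "{f i, f j} \<in> E"
    let ?s = "j - Suc i"
    \<comment> \<open>The chord replaces the \<open>j - i\<close> steps from \<open>i\<close> to
      \<open>j\<close> by one.\<close>
    have "W (n - ?s) (\<lambda>t. if t \<le> i then f t else f (t + ?s))"
      unfolding W_def
    proof (intro conjI allI impI)
      show "(if n - ?s \<le> i then f (n - ?s) else f (n - ?s + ?s)) = b"
        using that f(2) by auto
      fix t assume "t < n - ?s"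
      then show "{if t \<le> i then f t else f (t + ?s),
          if Suc t \<le> i then f (Suc t) else f (Suc t + ?s)} \<in> ?E"
        using f(3)[of t] f(3)[of "t + ?s"] that eq notD
        by (cases "t = i") (auto simp: not_less_eq_eq)
    qed (use f in auto)
    then show False
      using least[of "n - ?s"] that by auto
  qed
  have "n > 0"
    using f \<open>a \<noteq> b\<close> by (cases n) auto
  have "{f 1, d} \<in> E" if d: "d \<in> D" for d
  proof (rule ccontr)
    assume not1: "{f 1, d} \<notin> E"
    \<comment> \<open>The first position after \<open>0\<close> whose vertex is adjacent to
      \<open>d\<close>; it exists since \<open>f n = b\<close>. As \<open>f 1\<close> is not
      adjacent to \<open>d\<close>, \<open>d, f 0, ..., f j\<close> is a chordless cycle of length
      \<open>j + 2 \<ge> 4\<close>.\<close>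
    define j where "j = (LEAST j. j \<ge> 1 \<and> {f j, d} \<in> E)"
    have ex: "n \<ge> 1 \<and> {f n, d} \<in> E"
      using \<open>n > 0\<close> f b d by auto
    have j: "j \<ge> 1" "{f j, d} \<in> E"
      using LeastI[of "\<lambda>j. j \<ge> 1 \<and> {f j, d} \<in> E", OF ex] by (auto simp: j_def)
    have "j \<le> n"
      using Least_le[of "\<lambda>j. j \<ge> 1 \<and> {f j, d} \<in> E", OF ex] by (auto simp: j_def)
    have minj: "{f i, d} \<notin> E" if "1 \<le> i" "i < j" for i
      using not_less_Least[of i "\<lambda>j. j \<ge> 1 \<and> {f j, d} \<in> E"] that by (auto simp: j_def)
    have "j \<noteq> 1"
      using j not1 by auto
    then have "j \<ge> 2"
      using j by simp
    define g where "g i = (if i = 0 then d else f (i - 1))" for i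
    have "chordless_cycle E (j + 2) g"
    proof (rule chordless_cycleI)
      show "inj_on g {..<j + 2}"
      proof (rule linorder_inj_onI)
        fix x y :: nat assume "x < y" "x \<in> {..<j + 2}" "y \<in> {..<j + 2}"
        then have "y - 1 \<le> n" "x = 0 \<or> x - 1 < y - 1" "y \<noteq> 0"
          using \<open>j \<le> n\<close> by auto
        then show "g x \<noteq> g y"
          using dist[of "x - 1" "y - 1"] notD[of "y - 1"] d by (auto simp: g_def)
      qed auto
      fix i l assume il: "i < l" "l < j + 2"
      show "{g i, g l} \<in> E \<longleftrightarrow> l = Suc i \<or> i = 0 \<and> Suc l = j + 2"
      proof (cases "i = 0")
        case True
        show ?thesis
        proof (cases "l = 1 \<or> l = j + 1")
          case True
          then show ?thesis
            using \<open>i = 0\<close> a d j f(1) by (auto simp: g_def insert_commute)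
        next
          case False
          then have "{f (l - 1), d} \<notin> E"
            using minj[of "l - 1"] il \<open>i = 0\<close> by linarith
          then show ?thesis
            using False \<open>i = 0\<close> il by (auto simp: g_def insert_commute)
        qed
      next
        case False
        show ?thesis
        proof (cases "l = Suc i")
          case True
          then show ?thesis
            using f(3)[of "i - 1"] False il \<open>j \<le> n\<close> by (auto simp: g_def)
        next
          case neq: False
          then have "{f (i - 1), f (l - 1)} \<notin> E"
            using induced[of "i - 1" "l - 1"] il False \<open>j \<le> n\<close> by linarith
          then show ?thesis
            using False neq il by (auto simp: g_def)
        qed
      qed
    qed (use E2 \<open>j \<ge> 2\<close> in auto)
    then show False
      using \<open>chordal E\<close> by (auto simp: chordal_def)
  qed
  moreover have "{a, f 1} \<in> E" "f 1 \<notin> D"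
    using f(1) f(3)[of 0] \<open>n > 0\<close> notD[of 1] by auto
  ultimately show ?thesis
    using that by blast
qed

text \<open>Otherwise \<open>x, w, y, w'\<close> is a chordless 4-cycle. Hence common neighbours of
  two non-adjacent vertices form a clique.\<close>

lemma chordal_C4:
  assumes "chordal E" "\<forall>e\<in>E. card e = 2"
    and "{x, w} \<in> E" "{w, y} \<in> E" "{y, w'} \<in> E" "{x, w'} \<in> E"
    and "{x, y} \<notin> E" "x \<noteq> y" "w \<noteq> w'"
  shows "{w, w'} \<in> E"
proof (rule ccontr)
  assume nw: "{w, w'} \<notin> E"
  have "x \<noteq> w" "y \<noteq> w" "x \<noteq> w'" "y \<noteq> w'"
    using assms by fastforce+
  define f where "f i = [x, w, y, w'] ! i" for i
  have "chordless_cycle E 4 f"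
  proof (rule chordless_cycleI)
    have "distinct [x, w, y, w']"
      using assms \<open>x \<noteq> w\<close> \<open>y \<noteq> w\<close> \<open>x \<noteq> w'\<close> \<open>y \<noteq> w'\<close> by auto
    then show "inj_on f {..<4}"
      by (simp add: f_def[abs_def] inj_on_nth)
    fix i j :: nat assume "i < j" "j < 4"
    then have "(i, j) \<in> {(0,1), (0,2), (0,3), (1,2), (1,3), (2,3)}"
      by auto
    then show "{f i, f j} \<in> E \<longleftrightarrow> j = Suc i \<or> i = 0 \<and> Suc j = 4"
      using assms(3-7) nw by (elim insertE emptyE) (simp_all add: f_def)
  qed (use assms(2) in simp_all)
  then show False
    using \<open>chordal E\<close> by (auto simp: chordal_def)
qed

text \<open>A chordless cycle of \<open>H \<union> F\<close> through \<open>{x, y} \<in> F\<close> avoids the clique \<open>D\<close> of common neighbours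
  of \<open>x\<close> and \<open>y\<close>. Since \<open>H\<close> has no clique with more than \<open>k\<close> vertices, each component of \<open>H - D\<close> has at most
  one vertex adjacent to all of \<open>D\<close>, and an edge of \<open>F\<close> between two components joins two such
  vertices. Hence the rest of the cycle yields a second \<open>F\<close>-path from \<open>x\<close> to \<open>y\<close>.\<close>

lemma chordal_Un_forest:
  assumes H: "chordal H" and H2: "\<forall>e\<in>H. card e = 2" and F2: "\<forall>e\<in>F. card e = 2"
    and "H \<inter> F = {}" and forest: "is_forest F" and "k \<ge> 1"
    and omega: "\<And>Q. finite Q \<Longrightarrow> clique Q H \<Longrightarrow> card Q \<le> k"
    and cn: "\<And>x y. {x, y} \<in> F \<Longrightarrow> finite {w. {x, w} \<in> H \<and> {y, w} \<in> H}
      \<and> card {w. {x, w} \<in> H \<and> {y, w} \<in> H} = k - 1"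
  shows "chordal (H \<union> F)"
  unfolding chordal_def
proof
  assume "\<exists>n f. chordless_cycle (H \<union> F) n f"
  then obtain n f where f: "chordless_cycle (H \<union> F) n f"
    by blast
  have n: "n \<ge> 4"
    using f by (simp add: chordless_cycle_def)
  have "\<exists>s<n. {f s, f (Suc s mod n)} \<in> F"
  proof (rule ccontr)
    assume "\<not> ?thesis"
    then have nF: "\<And>s. s < n \<Longrightarrow> {f s, f (Suc s mod n)} \<notin> F"
      by blast
    have iff: "\<And>i j. i < n \<Longrightarrow> j < n \<Longrightarrow>
        {f i, f j} \<in> H \<union> F \<longleftrightarrow> j = Suc i mod n \<or> i = Suc j mod n"
      using f by (simp add: chordless_cycle_def)
    have "{f i, f j} \<notin> F" if "i < n" "j < n" for i j
      using iff[OF that] nF[of i] nF[of j] that by (auto simp: insert_commute)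
    then have "chordless_cycle H n f"
      using f unfolding chordless_cycle_def by blast
    then show False
      using H by (auto simp: chordal_def)
  qed
  then obtain s where s: "s < n" "{f s, f (Suc s mod n)} \<in> F"
    by blast
  \<comment> \<open>Rotated so that the edge of \<open>F\<close> found above joins the last vertex
    to the first.\<close>
  define g where "g i = f ((i + Suc s) mod n)" for i
  have g: "chordless_cycle (H \<union> F) n g"
    unfolding g_def using f by (rule chordless_cycle_rotate)
  define x y where "x = g 0" and "y = g (n - 1)"
  have "n - 1 + Suc s = s + n"
    using n by simp
  then have "y = f s"
    using s n by (simp add: y_def g_def del: add_Suc_right)
  then have xyF: "{x, y} \<in> F"
    using s by (simp add: x_def g_def insert_commute)
  have ginj: "inj_on g {..<n}" and giff: "\<And>i j. i < n \<Longrightarrow> j < n \<Longrightarrow>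
      {g i, g j} \<in> H \<union> F \<longleftrightarrow> j = Suc i mod n \<or> i = Suc j mod n"
    using g by (simp_all add: chordless_cycle_def)
  have "x \<noteq> y"
    using xyF F2 by fastforce
  have "{x, y} \<notin> H"
    using xyF \<open>H \<inter> F = {}\<close> by blast
  define D where "D = {w. {x, w} \<in> H \<and> {y, w} \<in> H}"
  have D: "finite D" "card D = k - 1"
    using cn[OF xyF] by (simp_all add: D_def)
  have Dclique: "clique D H"
    unfolding clique_def
  proof (intro ballI impI)
    fix w w' assume "w \<in> D" "w' \<in> D" "w \<noteq> w'"
    then show "{w, w'} \<in> H"
      using \<open>{x, y} \<notin> H\<close> \<open>x \<noteq> y\<close>
      by (intro chordal_C4[OF H H2, of x w y w']) (auto simp: D_def insert_commute)
  qed
  define full where "full a \<longleftrightarrow> (\<forall>d\<in>D. {a, d} \<in> H)" for a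
  have full_notin: "a \<notin> D" if "full a" for a
    using that H2 unfolding full_def by fastforce
  have xyfull: "full x" "full y"
    by (auto simp: full_def D_def)
  define HD where "HD = {e \<in> H. e \<inter> D = {}}"
  have unique: "a = b" if ab: "full a" "full b" "conn HD a b" for a b
  proof (rule ccontr)
    assume "a \<noteq> b"
    \<comment> \<open>\<open>D\<close> together with \<open>a\<close> and \<open>p\<close> will be a
      clique of \<open>k + 1\<close> vertices, contradicting \<open>omega\<close>.\<close>
    then obtain p where p: "p \<notin> D" "{a, p} \<in> H" "\<forall>d\<in>D. {p, d} \<in> H"
      using chordal_common_neighbour[OF H H2 ab(3)[unfolded HD_def]] ab full_notin
      unfolding full_def by metis
    have "a \<noteq> p"
      using p H2 by fastforce
    have "clique (insert a (insert p D)) H"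
      unfolding clique_def
    proof (intro ballI impI)
      have "{p, a} \<in> H" "\<forall>d\<in>D. {a, d} \<in> H \<and> {d, a} \<in> H \<and> {d, p} \<in> H"
        using p ab(1) by (simp_all add: full_def insert_commute)
      moreover fix v w
      assume "v \<in> insert a (insert p D)" "w \<in> insert a (insert p D)" "v \<noteq> w"
      ultimately show "{v, w} \<in> H"
        using Dclique p unfolding clique_def by auto
    qed
    then have "card (insert a (insert p D)) \<le> k"
      using D by (intro omega) simp_all
    then show False
      using D p \<open>a \<noteq> p\<close> full_notin[OF ab(1)] \<open>k \<ge> 1\<close> by simp
  qed
  \<comment> \<open>Such a vertex would be adjacent to both \<open>g 0\<close> and
    \<open>g (n - 1)\<close>, impossible for \<open>n \<ge> 4\<close>.\<close>
  have gD: "g i \<notin> D" if "i < n" for i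
  proof
    assume "g i \<in> D"
    then have "{g 0, g i} \<in> H \<union> F" "{g (n - 1), g i} \<in> H \<union> F"
      by (auto simp: D_def x_def y_def)
    then show False
      using giff[of 0 i] giff[of "n - 1" i] that n by (auto simp: mod_Suc split: if_splits)
  qed
  \<comment> \<open>Invariant along the cycle: the \<open>HD\<close> component of \<open>g t\<close>
    has a full vertex, reached from \<open>x\<close> by \<open>F\<close> without
    \<open>{x, y}\<close>.\<close>
  have "\<exists>a. full a \<and> conn (F - {{x, y}}) x a \<and> conn HD a (g t)" if "t < n" for t
    using that
  proof (induction t)
    case 0
    then show ?case
      using xyfull by (intro exI[of _ x]) (simp add: x_def)
  next
    case (Suc t)
    then obtain a where a: "full a" "conn (F - {{x, y}}) x a" "conn HD a (g t)"
      by auto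
    have e: "{g t, g (Suc t)} \<in> H \<union> F"
      using giff[of t "Suc t"] Suc.prems by simp
    show ?case
    proof (cases "conn HD (g t) (g (Suc t))")
      case True
      then show ?thesis
        using a conn_trans by metis
    next
      case False
      then have "{g t, g (Suc t)} \<notin> H"
        using gD[of t] gD[of "Suc t"] Suc.prems conn_edge[of "g t" "g (Suc t)" HD]
        by (auto simp: HD_def)
      then have eF: "{g t, g (Suc t)} \<in> F"
        using e by blast
      define D' where "D' = {w. {g t, w} \<in> H \<and> {g (Suc t), w} \<in> H}"
      \<comment> \<open>A common neighbour outside \<open>D\<close> would join both vertices within
        \<open>HD\<close>. Equal cardinality then gives \<open>D' = D\<close>.\<close>
      have "D' \<subseteq> D"
      proof (rule subsetI, rule ccontr)
        fix w assume "w \<in> D'" "w \<notin> D"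
        then have "{g t, w} \<in> HD" "{w, g (Suc t)} \<in> HD"
          using gD Suc.prems by (auto simp: HD_def D'_def insert_commute)
        then show False
          using False conn_edge conn_trans by metis
      qed
      moreover have "card D' = card D"
        using cn[OF eF] D by (simp add: D'_def)
      ultimately have "D' = D"
        using D card_subset_eq by blast
      then have "full (g t)" "full (g (Suc t))"
        by (auto simp: full_def D'_def)
      then have "a = g t"
        using a unique by blast
      have "{g t, g (Suc t)} \<noteq> {x, y}"
      proof
        assume "{g t, g (Suc t)} = {x, y}"
        then have "g (Suc t) = g 0 \<or> g t = g 0 \<and> g (Suc t) = g (n - 1)"
          by (auto simp: doubleton_eq_iff x_def y_def)
        then have "Suc t = 0 \<or> t = 0 \<and> Suc t = n - 1"
          using inj_onD[OF ginj, of "Suc t" 0] inj_onD[OF ginj, of t 0]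
            inj_onD[OF ginj, of "Suc t" "n - 1"] Suc.prems n by auto
        then show False
          using n by auto
      qed
      then have "conn (F - {{x, y}}) (g t) (g (Suc t))"
        using eF by (intro conn_edge) simp
      then have "conn (F - {{x, y}}) x (g (Suc t))"
        using a \<open>a = g t\<close> conn_trans by metis
      then show ?thesis
        using \<open>full (g (Suc t))\<close> by (intro exI[of _ "g (Suc t)"]) simp
    qed
  qed
  from this[of "n - 1"] obtain a where "full a" "conn (F - {{x, y}}) x a" "conn HD a y"
    using n by (auto simp: y_def)
  then have "conn (F - {{x, y}}) x y"
    using unique xyfull by blast
  then show False
    using forest xyF \<open>x \<noteq> y\<close> by (auto simp: is_forest_iff)
qed

section \<open>MAT-labelings\<close>

lemma MAT_labeling_cong:
  assumes "\<forall>e\<in>edges H. lam e = lam' e" "MAT_labeling H lam"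
  shows "MAT_labeling H lam'"
proof -
  have "label_class H lam = label_class H lam'"
    using assms(1) by (auto simp: label_class_def fun_eq_iff)
  then show ?thesis
    using assms by (simp add: MAT_labeling_def label_upto_def)
qed

locale MAT_graph =
  fixes H :: "'a graph" and lam :: "'a set \<Rightarrow> nat"
  assumes simple: "finite_simple_graph H" and MAT: "MAT_labeling H lam"
begin

abbreviation P where "P \<equiv> label_class H lam"
abbreviation E where "E \<equiv> label_upto H lam"

lemma edge_pos: "e \<in> edges H \<Longrightarrow> lam e > 0"
  using MAT by (simp add: MAT_labeling_def)

lemma edge_card: "e \<in> edges H \<Longrightarrow> card e = 2"
  and edge_subset: "e \<in> edges H \<Longrightarrow> e \<subseteq> verts H"
  and finite_verts: "finite (verts H)"
  using simple by (auto simp: finite_simple_graph_def)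

lemma edge_neq: "{u, v} \<in> edges H \<Longrightarrow> u \<noteq> v"
  using edge_card by fastforce

lemma finite_edges: "finite (edges H)"
  by (rule finite_subset[of _ "Pow (verts H)"]) (use edge_subset finite_verts in auto)

lemma in_P: "e \<in> P k \<longleftrightarrow> e \<in> edges H \<and> lam e = k"
  by (simp add: label_class_def)

lemma in_E: "e \<in> E k \<longleftrightarrow> e \<in> edges H \<and> lam e \<le> k"
  using edge_pos by (fastforce simp: label_upto_def in_P)

lemma P_pos: "e \<in> P k \<Longrightarrow> k \<ge> 1"
  using edge_pos by (fastforce simp: in_P)

lemma forest_P: "k \<ge> 1 \<Longrightarrow> is_forest (P k)"
  using MAT by (simp add: MAT_labeling_def)

text \<open>This is (ML2) in terms of \<open>conn\<close>: otherwise the edge lies both in the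
  closure of \<open>P k\<close> and in \<open>E (k - 1)\<close>.\<close>

lemma conn_P_le:
  assumes "k \<ge> 1" "{u, v} \<in> edges H" "conn (P k) u v"
  shows "k \<le> lam {u, v}"
proof (rule ccontr)
  assume "\<not> ?thesis"
  then have "{u, v} \<in> E (k - 1)"
    using assms by (simp add: in_E)
  moreover have "{u, v} \<in> edge_closure H (P k)"
    using assms by (auto simp: edge_closure_iff)
  ultimately show False
    using MAT \<open>k \<ge> 1\<close> by (auto simp: MAT_labeling_def)
qed

text \<open>The two edges join \<open>u\<close> to \<open>w\<close>, so (ML2) excludes smaller
  labels; label \<open>k\<close> would close a triangle in the forest \<open>P k\<close>.\<close>

lemma triangle_less:
  assumes "{u, v} \<in> P k" "{v, w} \<in> P k" "{u, w} \<in> edges H"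
  shows "k < lam {u, w}"
proof -
  have "k \<ge> 1"
    using assms(1) by (rule P_pos)
  have neq: "u \<noteq> v" "v \<noteq> w" "u \<noteq> w"
    using assms edge_neq by (auto simp: in_P)
  have "k \<le> lam {u, w}"
    using assms \<open>k \<ge> 1\<close> by (intro conn_P_le) (blast intro: conn_edge conn_trans)+
  moreover have "lam {u, w} \<noteq> k"
  proof
    assume "lam {u, w} = k"
    then have "{u, w} \<in> P k"
      using assms by (simp add: in_P)
    moreover have "{u, v} \<in> P k - {{u, w}}" "{v, w} \<in> P k - {{u, w}}"
      using assms neq by (auto simp: doubleton_eq_iff)
    ultimately show False
      using forest_P[OF \<open>k \<ge> 1\<close>] neq conn_edge conn_trans unfolding is_forest_iff by metis
  qed
  ultimately show ?thesis
    by simp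
qed

section \<open>Common neighbours, cliques and chordality\<close>

definition common :: "nat \<Rightarrow> 'a \<Rightarrow> 'a \<Rightarrow> 'a set" where
  "common k u v = {w. {u, w} \<in> E k \<and> {v, w} \<in> E k}"

lemma common_subset: "common k u v \<subseteq> verts H - {u, v}"
  using edge_subset edge_neq by (auto simp: common_def in_E)

lemma finite_common: "finite (common k u v)"
  using common_subset finite_verts by (meson finite_Diff finite_subset)

lemma card_common:
  assumes "{u, v} \<in> P k"
  shows "card (common (k - 1) u v) = k - 1"
proof -
  have "common (k - 1) u v = {w \<in> verts H. {u, w} \<in> E (k - 1) \<and> {v, w} \<in> E (k - 1)}"
    using common_subset by (auto simp: common_def)
  then show ?thesis
    using MAT P_pos[OF assms] assms by (simp add: MAT_labeling_def)
qed

text \<open>If a clique edge \<open>{x, y}\<close> has the top label, \<open>triangle_less\<close>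
  gives every other clique edge at \<open>x\<close> or \<open>y\<close> a smaller one. So the other
  vertices are common neighbours, which (ML3) counts.\<close>

lemma card_clique_le:
  assumes "finite Q" "clique Q (E k)"
  shows "card Q \<le> k + 1"
  using assms
proof (induction k)
  case 0
  have "x = y" if "x \<in> Q" "y \<in> Q" for x y
    using that 0 edge_pos by (fastforce simp: clique_def in_E)
  then show ?case
    using card_le_Suc0_iff_eq[OF \<open>finite Q\<close>] by auto
next
  case (Suc k)
  show ?case
  proof (cases "clique Q (E k)")
    case True
    then show ?thesis
      using Suc by simp
  next
    case False
    then obtain x y where xy: "x \<in> Q" "y \<in> Q" "x \<noteq> y" "{x, y} \<notin> E k"
      by (auto simp: clique_def)
    have edge: "{v, w} \<in> edges H" "lam {v, w} \<le> Suc k" if "v \<in> Q" "w \<in> Q" "v \<noteq> w" for v w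
      using that Suc.prems by (auto simp: clique_def in_E)
    have xyP: "{x, y} \<in> P (Suc k)"
      using edge[of x y] xy by (auto simp: in_P in_E)
    have "Q - {x, y} \<subseteq> common k x y"
    proof
      fix w assume w: "w \<in> Q - {x, y}"
      have "lam {x, w} \<noteq> Suc k"
        using triangle_less[of y x "Suc k" w] xyP edge[of x w] edge[of y w] xy w
        by (auto simp: in_P insert_commute)
      moreover have "lam {y, w} \<noteq> Suc k"
        using triangle_less[of x y "Suc k" w] xyP edge[of x w] edge[of y w] xy w
        by (auto simp: in_P)
      ultimately show "w \<in> common k x y"
        using edge[of x w] edge[of y w] xy w by (auto simp: common_def in_E)
    qed
    then have "card (Q - {x, y}) \<le> k"
      using card_common[OF xyP] card_mono[OF finite_common, of "Q - {x, y}" k x y] by simp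
    moreover have "card (Q - {x, y}) = card Q - 2"
      using xy by (simp add: card_Diff_subset)
    ultimately show ?thesis
      by simp
  qed
qed

text \<open>\<open>E (Suc k)\<close> adds the forest \<open>P (Suc k)\<close> to \<open>E k\<close>;
  \<open>card_clique_le\<close> and (ML3) supply the clique bound and the number of common
  neighbours for \<open>chordal_Un_forest\<close>.\<close>

lemma chordal_E: "chordal (E k)"
proof (induction k)
  case 0
  have "\<not> chordless_cycle (E 0) n f" for n f
  proof
    assume "chordless_cycle (E 0) n f"
    then have "{f 0, f (Suc 0)} \<in> E 0"
      unfolding chordless_cycle_def by auto
    then show False
      using edge_pos[of "{f 0, f (Suc 0)}"] by (simp add: in_E)
  qed
  then show ?case
    by (simp add: chordal_def)
next
  case (Suc k)
  have "chordal (E k \<union> P (Suc k))"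
  proof (rule chordal_Un_forest[where k = "Suc k"])
    show "card Q \<le> Suc k" if "finite Q" "clique Q (E k)" for Q
      using card_clique_le[OF that] by simp
    show "finite {w. {x, w} \<in> E k \<and> {y, w} \<in> E k}
        \<and> card {w. {x, w} \<in> E k \<and> {y, w} \<in> E k} = Suc k - 1"
      if "{x, y} \<in> P (Suc k)" for x y
      using finite_common[of k x y] card_common[OF that] by (simp add: common_def)
  qed (use Suc forest_P edge_card in \<open>auto simp: in_E in_P\<close>)
  moreover have "E (Suc k) = E k \<union> P (Suc k)"
    by (auto simp: in_E in_P)
  ultimately show ?case
    by simp
qed

text \<open>Take one end of \<open>e\<close> and the \<open>k - 1\<close> common neighbours of its
  ends. The latter are pairwise adjacent by \<open>chordal_C4\<close>, because \<open>e\<close> is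
  not in \<open>E (k - 1)\<close>.\<close>

lemma ex_clique:
  assumes "e \<in> P k"
  obtains Q where "Q \<subseteq> verts H" "card Q = k" "clique Q (E (k - 1))"
proof -
  obtain x y where e: "e = {x, y}" "x \<noteq> y"
    using assms edge_card by (metis card_2_iff in_P)
  have xyP: "{x, y} \<in> P k"
    using assms e by simp
  have "k \<ge> 1"
    using assms by (rule P_pos)
  have E2: "\<forall>e\<in>E (k - 1). card e = 2"
    using edge_card by (simp add: in_E)
  let ?D = "common (k - 1) x y"
  have "clique (insert x ?D) (E (k - 1))"
    unfolding clique_def
  proof (intro ballI impI)
    fix v w assume vw: "v \<in> insert x ?D" "w \<in> insert x ?D" "v \<noteq> w"
    show "{v, w} \<in> E (k - 1)"
    proof (cases "v = x \<or> w = x")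
      case True
      then show ?thesis
        using vw by (auto simp: common_def insert_commute)
    next
      case False
      then have "v \<in> ?D" "w \<in> ?D"
        using vw by auto
      moreover have "{x, y} \<notin> E (k - 1)"
        using xyP \<open>k \<ge> 1\<close> by (auto simp: in_E in_P)
      ultimately show ?thesis
        using vw e by (intro chordal_C4[OF chordal_E E2, of x v y w])
          (auto simp: common_def insert_commute)
    qed
  qed
  moreover have "card (insert x ?D) = k"
    using card_common[OF xyP] finite_common common_subset[of "k - 1" x y] \<open>k \<ge> 1\<close>
    by (subst card_insert_disjoint) auto
  moreover have "insert x ?D \<subseteq> verts H"
    using common_subset edge_subset xyP by (fastforce simp: in_P)
  ultimately show ?thesis
    using that by blast
qed

section \<open>Sizes of the label classes\<close>

lemma lam_less_card:
  assumes "e \<in> edges H"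
  shows "lam e < card (verts H)"
proof -
  obtain x y where e: "e = {x, y}" "x \<noteq> y"
    using assms edge_card by (metis card_2_iff)
  let ?D = "common (lam e - 1) x y"
  have "{x, y} \<in> P (lam e)"
    using assms e by (simp add: in_P)
  then have "card ?D = lam e - 1"
    by (rule card_common)
  \<comment> \<open>The common neighbours and the two ends are \<open>lam e + 1\<close> distinct
    vertices.\<close>
  moreover have "card (?D \<union> {x, y}) = card ?D + card {x, y}"
    using finite_common common_subset[of "lam e - 1" x y] by (intro card_Un_disjoint) auto
  moreover have "card (?D \<union> {x, y}) \<le> card (verts H)"
    using common_subset[of "lam e - 1" x y] edge_subset[OF assms] e finite_verts
    by (intro card_mono) auto
  ultimately show ?thesis
    using edge_pos[OF assms] e by simp
qed

lemma card_P_add_le: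
  assumes "k \<ge> 1" "Q \<subseteq> verts H" "\<forall>p\<in>Q. \<forall>q\<in>Q. p \<noteq> q \<longrightarrow> \<not> conn (P k) p q"
  shows "card (P k) + card Q \<le> card (verts H)"
proof (rule forest_card_le)
  show "finite (P k)"
    using finite_edges by (auto simp: label_class_def)
qed (use assms forest_P finite_verts edge_card edge_subset in \<open>auto simp: in_P\<close>)

lemma clique_E_not_conn_P:
  assumes "clique Q (E (k - 1))" "k \<ge> 1" "p \<in> Q" "q \<in> Q" "p \<noteq> q"
  shows "\<not> conn (P k) p q"
proof
  assume "conn (P k) p q"
  moreover have "{p, q} \<in> E (k - 1)"
    using assms by (simp add: clique_def)
  ultimately show False
    using conn_P_le[OF \<open>k \<ge> 1\<close>, of p q] \<open>k \<ge> 1\<close> by (auto simp: in_E)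
qed

lemma card_P_le:
  assumes "k \<ge> 1" "k < card (verts H)"
  shows "card (P k) \<le> card (verts H) - k"
proof (cases "P k = {}")
  case False
  then obtain Q where "Q \<subseteq> verts H" "card Q = k" "clique Q (E (k - 1))"
    using ex_clique by blast
  then show ?thesis
    using card_P_add_le[OF assms(1), of Q] clique_E_not_conn_P assms(1) by fastforce
qed simp

text \<open>The bounds of \<open>card_P_le\<close> add up to the number of edges of the complete
  graph, so each is attained.\<close>

lemma card_P_complete:
  assumes "clique (verts H) (edges H)" "1 \<le> k" "k < card (verts H)"
  shows "card (P k) = card (verts H) - k"
proof -
  let ?c = "card (verts H)"
  have "edges H = {e. e \<subseteq> verts H \<and> card e = 2}"
  proof (intro subset_antisym subsetI)
    fix e assume "e \<in> {e. e \<subseteq> verts H \<and> card e = 2}"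
    then show "e \<in> edges H"
      using assms(1) by (auto simp: clique_def card_2_iff)
  qed (use edge_card edge_subset in blast)
  then have "card (edges H) = ?c choose 2"
    using n_subsets[OF finite_verts] by simp
  also have "\<dots> = (\<Sum>k\<in>{1..<?c}. ?c - k)"
  proof -
    have "(\<Sum>k\<in>{1..<c}. c - k) = c choose 2" for c :: nat
    proof (induction c)
      case (Suc c)
      have "(\<Sum>k\<in>{1..<Suc c}. Suc c - k) = (\<Sum>k\<in>{1..<Suc c}. (c - k) + 1)"
        by (intro sum.cong) auto
      also have "\<dots> = (\<Sum>k\<in>{1..<Suc c}. c - k) + c"
        by (subst sum.distrib) simp
      also have "(\<Sum>k\<in>{1..<Suc c}. c - k) = (\<Sum>k\<in>{1..<c}. c - k)"
        by (cases "c \<ge> 1") auto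
      finally show ?case
        using Suc by (simp add: numeral_2_eq_2)
    qed simp
    then show ?thesis
      by simp
  qed
  finally have "card (edges H) = (\<Sum>k\<in>{1..<?c}. ?c - k)" .
  moreover have "card (edges H) = (\<Sum>k\<in>{1..<?c}. card (P k))"
  proof -
    have "edges H = (\<Union>k\<in>{1..<?c}. P k)"
      using lam_less_card edge_pos by (fastforce simp: in_P)
    then have "card (edges H) = card (\<Union>k\<in>{1..<?c}. P k)"
      by simp
    also have "\<dots> = (\<Sum>k\<in>{1..<?c}. card (P k))"
      using finite_edges by (intro card_UN_disjoint) (auto simp: label_class_def)
    finally show ?thesis .
  qed
  ultimately have "(\<Sum>k\<in>{1..<?c}. card (P k)) = (\<Sum>k\<in>{1..<?c}. ?c - k)"
    by simp
  then show ?thesis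
    by (rule sum_mono_inv) (use assms card_P_le in auto)
qed

end

text \<open>By \<open>card_P_complete\<close> the class \<open>\<pi>\<^sub>k\<close> splits \<open>C\<close> into exactly \<open>k\<close> components, while a \<open>k\<close>-clique of
  edges of smaller label in \<open>C\<close> prevents the class \<open>\<pi>\<^sub>k\<close> of the larger graph from merging them.\<close>

lemma conn_label_class_clique:
  assumes H: "MAT_graph H lam" and K: "MAT_graph (induced_subgraph H C) lam"
    and "C \<subseteq> verts H" and C: "clique C (edges H)" and "k \<ge> 1"
    and xy: "x \<in> C" "y \<in> C" and conn: "conn (label_class H lam k) x y"
  shows "conn (label_class (induced_subgraph H C) lam k) x y"
proof (rule ccontr)
  assume not: "\<not> ?thesis"
  interpret H: MAT_graph H lam by (fact H)
  interpret K: MAT_graph "induced_subgraph H C" lam by (fact K)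
  have vK: "verts (induced_subgraph H C) = C"
    and eK: "e \<in> edges (induced_subgraph H C) \<longleftrightarrow> e \<in> edges H \<and> e \<subseteq> C" for e
    by (simp_all add: induced_subgraph_def)
  have PK: "K.P k \<subseteq> H.P k"
    by (auto simp: K.in_P H.in_P eK)
  have "x \<noteq> y"
    using not by auto
  then have "{x, y} \<in> edges H"
    using C xy by (simp add: clique_def)
  \<comment> \<open>(ML2) in \<open>H\<close> gives the first bound, \<open>lam_less_card\<close> in
    the subgraph on \<open>C\<close> the second; together they bring \<open>k\<close> into the range
    of \<open>card_P_complete\<close>.\<close>
  then have "k \<le> lam {x, y}" "lam {x, y} < card C"
    using H.conn_P_le \<open>k \<ge> 1\<close> conn K.lam_less_card[of "{x, y}"] xy by (auto simp: vK eK)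
  then have "k < card C"
    by simp
  have "clique C (edges (induced_subgraph H C))"
    using C by (auto simp: clique_def eK)
  then have card: "card (K.P k) = card C - k"
    using K.card_P_complete[of k] \<open>k \<ge> 1\<close> \<open>k < card C\<close> by (simp add: vK)
  then have "K.P k \<noteq> {}"
    using \<open>k < card C\<close> by auto
  then obtain Q where Q: "Q \<subseteq> C" "card Q = k" "clique Q (K.E (k - 1))"
    using K.ex_clique by (metis ex_in_conv vK)
  have "clique Q (H.E (k - 1))"
    using Q(3) by (auto simp: clique_def K.in_E H.in_E eK)
  then have ncH: "\<not> conn (H.P k) p q" if "p \<in> Q" "q \<in> Q" "p \<noteq> q" for p q
    using H.clique_E_not_conn_P \<open>k \<ge> 1\<close> that by blast
  have KH: "conn (H.P k) p q" if "conn (K.P k) p q" for p q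
    using that PK by (rule conn_mono)
  \<comment> \<open>One of \<open>x\<close>, \<open>y\<close> works: if both were joined to
    \<open>Q\<close> within \<open>C\<close>, the walk in \<open>H\<close> would force the same
    vertex of \<open>Q\<close>, joining \<open>x\<close> to \<open>y\<close> within
    \<open>C\<close>.\<close>
  have "\<exists>z\<in>C. \<forall>q\<in>Q. \<not> conn (K.P k) q z"
  proof (rule ccontr)
    assume "\<not> ?thesis"
    then obtain p q where pq: "p \<in> Q" "conn (K.P k) p x" "q \<in> Q" "conn (K.P k) q y"
      using xy by blast
    then have "conn (H.P k) p q"
      using KH conn conn_sym conn_trans by metis
    then have "p = q"
      using ncH pq by blast
    then show False
      using pq not conn_sym conn_trans by metis
  qed
  then obtain z where z: "z \<in> C" "\<forall>q\<in>Q. \<not> conn (K.P k) q z"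
    by blast
  have "z \<notin> Q"
    using z by auto
  have "\<forall>p\<in>insert z Q. \<forall>q\<in>insert z Q. p \<noteq> q \<longrightarrow> \<not> conn (K.P k) p q"
    using z ncH KH conn_sym by (metis insert_iff)
  \<comment> \<open>The left side is \<open>(card C - k) + (k + 1)\<close>, a contradiction.\<close>
  then have "card (K.P k) + card (insert z Q) \<le> card C"
    using K.card_P_add_le[of k "insert z Q"] \<open>k \<ge> 1\<close> z Q by (simp add: vK)
  moreover have "finite Q"
    using Q \<open>C \<subseteq> verts H\<close> H.finite_verts by (meson finite_subset)
  ultimately show False
    using card Q(2) \<open>z \<notin> Q\<close> \<open>k < card C\<close> by simp
qed

section \<open>Gluing along a clique\<close>

lemma in_label_upto: "e \<in> label_upto H lam k \<longleftrightarrow> e \<in> edges H \<and> 1 \<le> lam e \<and> lam e \<le> k"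
  by (auto simp: label_upto_def label_class_def)

text \<open>One \<open>lam\<close> serves all three subgraphs, since labelings matter only on edges,
  where the given ones agree.\<close>

locale MAT_gluing =
  fixes G :: "'a graph" and A B :: "'a set" and lam :: "'a set \<Rightarrow> nat"
  assumes verts: "verts G = A \<union> B"
    and edges: "\<forall>e\<in>edges G. e \<subseteq> A \<or> e \<subseteq> B"
    and meet: "clique (A \<inter> B) (edges G)"
    and A: "MAT_graph (induced_subgraph G A) lam"
    and B: "MAT_graph (induced_subgraph G B) lam"
    and C: "MAT_graph (induced_subgraph G (A \<inter> B)) lam"
begin

sublocale A: MAT_graph "induced_subgraph G A" lam by (fact A)
sublocale B: MAT_graph "induced_subgraph G B" lam by (fact B)
sublocale C: MAT_graph "induced_subgraph G (A \<inter> B)" lam by (fact C)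

text \<open>By this symmetry, results on edges in \<open>A\<close> carry over to
  \<open>B\<close>.\<close>

lemma swap: "MAT_gluing G B A lam"
  by (rule MAT_gluing.intro) (use verts edges meet A B C in \<open>auto simp: Int_commute Un_commute\<close>)

lemma edges_induced: "e \<in> edges (induced_subgraph G X) \<longleftrightarrow> e \<in> edges G \<and> e \<subseteq> X"
  by (simp add: induced_subgraph_def)

lemma label_class_eq: "label_class G lam k = A.P k \<union> B.P k"
  using edges by (auto simp: label_class_def edges_induced)

lemma conn_meet:
  assumes "k \<ge> 1" "x \<in> A \<inter> B" "y \<in> A \<inter> B" "conn (A.P k) x y"
  shows "conn (C.P k) x y"
proof -
  have eq: "induced_subgraph (induced_subgraph G A) (A \<inter> B) = induced_subgraph G (A \<inter> B)"
    by (auto simp: induced_subgraph_def)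
  have "clique (A \<inter> B) (edges (induced_subgraph G A))"
    using meet by (auto simp: clique_def edges_induced)
  then show ?thesis
    using conn_label_class_clique[OF A, of "A \<inter> B" k x y, unfolded eq, OF C] assms
    by (simp add: induced_subgraph_def)
qed

lemma C_subset: "C.P k \<subseteq> A.P k" "C.P k \<subseteq> B.P k"
  by (auto simp: A.in_P B.in_P C.in_P edges_induced)

text \<open>Stretches in \<open>B\<close> are rerouted: \<open>conn_meet\<close> with
  \<open>A\<close> and \<open>B\<close> exchanged moves them into \<open>A \<inter> B\<close>, hence
  into \<open>A\<close>.\<close>

lemma conn_A:
  assumes "k \<ge> 1" "u \<in> A" "v \<in> A" "conn (label_class G lam k) u v"
  shows "conn (A.P k) u v"
proof (rule conn_glue)
  show "conn (A.P k \<union> B.P k) u v"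
    using assms by (simp add: label_class_eq)
  fix x y assume "x \<in> A \<inter> B" "y \<in> A \<inter> B" "conn (B.P k) x y"
  then have "conn (C.P k) x y"
    using MAT_gluing.conn_meet[OF swap \<open>k \<ge> 1\<close>, of x y] by (simp add: Int_commute)
  then show "conn (A.P k) x y"
    using C_subset conn_mono by metis
qed (use assms in \<open>auto simp: A.in_P B.in_P edges_induced\<close>)

text \<open>Rerouting as in \<open>conn_A\<close>, but the walk in \<open>A \<inter> B\<close> must
  also avoid \<open>{u, v}\<close>; this uses that \<open>B.P k\<close> is a forest.\<close>

lemma forest_A:
  assumes "{u, v} \<in> A.P k"
  shows "\<not> conn (label_class G lam k - {{u, v}}) u v"
proof
  let ?e = "{{u, v}}"
  assume conn: "conn (label_class G lam k - ?e) u v"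
  have "k \<ge> 1"
    using assms by (rule A.P_pos)
  have uv: "u \<in> A" "v \<in> A" "u \<noteq> v"
    using assms A.edge_neq by (auto simp: A.in_P edges_induced)
  have "conn (A.P k - ?e) u v"
  proof (rule conn_glue)
    show "conn (A.P k - ?e \<union> (B.P k - ?e)) u v"
      using conn by (simp add: label_class_eq Un_Diff)
    fix x y assume xy: "x \<in> A \<inter> B" "y \<in> A \<inter> B" and B: "conn (B.P k - ?e) x y"
    have "conn (B.P k) x y"
      using B by (rule conn_mono) auto
    then have "conn (C.P k) x y"
      using MAT_gluing.conn_meet[OF swap \<open>k \<ge> 1\<close>, of x y] xy by (simp add: Int_commute)
    have "conn (C.P k - ?e) x y"
    proof (cases "{u, v} \<in> C.P k")
      case False
      then show ?thesis
        using \<open>conn (C.P k) x y\<close> by simp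
    next
      \<comment> \<open>If the walk in \<open>A \<inter> B\<close> had to cross
        \<open>{u, v}\<close>, its two remaining parts and the given walk in \<open>B\<close> from
        \<open>x\<close> to \<open>y\<close> would join \<open>u\<close> to \<open>v\<close> in
        \<open>B\<close> without that edge.\<close>
      case True
      then have not_uv: "\<not> conn (B.P k - ?e) u v"
        using C_subset B.forest_P[OF \<open>k \<ge> 1\<close>] uv unfolding is_forest_iff by blast
      have CB: "conn (B.P k - ?e) p q" if "conn (C.P k - ?e) p q" for p q
        using that by (rule conn_mono) (use C_subset in auto)
      have "\<not> (conn (C.P k - ?e) x u \<and> conn (C.P k - ?e) v y)"
      proof
        assume "conn (C.P k - ?e) x u \<and> conn (C.P k - ?e) v y"
        then have "conn (B.P k - ?e) u x" "conn (B.P k - ?e) y v"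
          using CB[THEN conn_sym] by blast+
        then show False
          using conn_trans[OF conn_trans[OF _ B]] not_uv by blast
      qed
      moreover have "\<not> (conn (C.P k - ?e) x v \<and> conn (C.P k - ?e) u y)"
      proof
        assume "conn (C.P k - ?e) x v \<and> conn (C.P k - ?e) u y"
        then have "conn (B.P k - ?e) u y" "conn (B.P k - ?e) x v"
          using CB by blast+
        then show False
          using conn_trans[OF conn_trans[OF _ conn_sym[OF B]]] not_uv by blast
      qed
      ultimately show ?thesis
        using conn_delete_edge[OF \<open>conn (C.P k) x y\<close>, of u v] by blast
    qed
    then show "conn (A.P k - ?e) x y"
      by (rule conn_mono) (use C_subset in auto)
  qed (use uv in \<open>auto simp: A.in_P B.in_P edges_induced\<close>)
  then show False
    using A.forest_P[OF \<open>k \<ge> 1\<close>] assms uv unfolding is_forest_iff by blast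
qed

text \<open>For an edge inside \<open>A \<inter> B\<close>, counting shows that its common neighbours of smaller label in \<open>A\<close>, and
  likewise in \<open>B\<close>, all lie in \<open>A \<inter> B\<close>.\<close>

lemma card_common_A:
  assumes "{u, v} \<in> A.P k"
  shows "card {w \<in> verts G. {u, w} \<in> label_upto G lam (k - 1) \<and> {v, w} \<in> label_upto G lam (k - 1)}
    = k - 1"
    (is "card ?D = _")
proof -
  have uvA: "u \<in> A" "v \<in> A" "{u, v} \<in> edges G"
    using assms by (auto simp: A.in_P edges_induced)
  have D: "w \<in> ?D \<longleftrightarrow> w \<in> A.common (k - 1) u v" if "w \<in> A" for w
    using that uvA verts by (auto simp: A.common_def in_label_upto edges_induced)
  have D_sub: "A.common (k - 1) u v \<subseteq> A"
    using A.common_subset by (auto simp: induced_subgraph_def)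
  show ?thesis
  proof (cases "u \<in> B \<and> v \<in> B")
    case False
    \<comment> \<open>An end outside \<open>B\<close> forces every edge at it into
      \<open>A\<close>.\<close>
    have "w \<in> A" if "w \<in> ?D" for w
      using that False edges by (auto simp: in_label_upto)
    then have "?D = A.common (k - 1) u v"
      using D D_sub by blast
    then show ?thesis
      using A.card_common[OF assms] by simp
  next
    case True
    then have P: "{u, v} \<in> C.P k" "{u, v} \<in> B.P k"
      using assms uvA by (auto simp: A.in_P B.in_P C.in_P edges_induced)
    have DB: "w \<in> ?D \<longleftrightarrow> w \<in> B.common (k - 1) u v" if "w \<in> B" for w
      using that True uvA verts by (auto simp: B.common_def in_label_upto edges_induced)
    have "C.common (k - 1) u v = A.common (k - 1) u v"
      using A.card_common[OF assms] C.card_common[OF P(1)]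
      by (intro card_subset_eq A.finite_common)
        (auto simp: A.common_def C.common_def in_label_upto edges_induced)
    moreover have "C.common (k - 1) u v = B.common (k - 1) u v"
      using B.card_common[OF P(2)] C.card_common[OF P(1)]
      by (intro card_subset_eq B.finite_common)
        (auto simp: B.common_def C.common_def in_label_upto edges_induced)
    moreover have "?D \<subseteq> A \<union> B"
      using verts by auto
    ultimately have "?D = C.common (k - 1) u v"
      using D DB D_sub by blast
    then show ?thesis
      using C.card_common[OF P(1)] by simp
  qed
qed

text \<open>By \<open>conn_A\<close> the ends of \<open>e\<close> are already joined in
  \<open>A\<close>, where (ML2) applies.\<close>

lemma closure_A:
  assumes "k \<ge> 1" "e \<in> edge_closure G (label_class G lam k)" "e \<subseteq> A"
  shows "e \<notin> label_upto G lam (k - 1)"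
proof -
  obtain u v where e: "e = {u, v}" "e \<in> edges G" "conn (label_class G lam k) u v"
    using assms(2) by (auto simp: edge_closure_iff)
  then have "conn (A.P k) u v"
    using assms by (intro conn_A) auto
  then have "k \<le> lam e"
    using A.conn_P_le[OF \<open>k \<ge> 1\<close>, of u v] e assms(3) by (simp add: edges_induced)
  then show ?thesis
    using \<open>k \<ge> 1\<close> by (auto simp: in_label_upto)
qed

lemma MAT_labeling_glue: "MAT_labeling G lam"
proof -
  interpret swap: MAT_gluing G B A lam by (fact swap)
  have "lam e > 0" if "e \<in> edges G" for e
    using that edges A.edge_pos[of e] B.edge_pos[of e] by (auto simp: edges_induced)
  moreover have "is_forest (label_class G lam k)" for k
    unfolding is_forest_iff using forest_A swap.forest_A label_class_eq by blast
  moreover have "edge_closure G (label_class G lam k) \<inter> label_upto G lam (k - 1) = {}"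
    if "k \<ge> 1" for k
    using closure_A[OF that] swap.closure_A[OF that] edges by (fastforce simp: edge_closure_iff)
  moreover have "card {w \<in> verts G. {u, w} \<in> label_upto G lam (k - 1) \<and>
      {v, w} \<in> label_upto G lam (k - 1)} = k - 1" if "{u, v} \<in> label_class G lam k" for u v k
    using that card_common_A swap.card_common_A label_class_eq by blast
  ultimately show ?thesis
    unfolding MAT_labeling_def by blast
qed

end

lemma MAT_graph_induced_subgraph:
  assumes "finite_simple_graph G" "X \<subseteq> verts G" "MAT_labeling (induced_subgraph G X) lam'"
    and "\<forall>e\<in>edges (induced_subgraph G X). lam' e = lam e"
  shows "MAT_graph (induced_subgraph G X) lam"
proof
  show "finite_simple_graph (induced_subgraph G X)"
    using assms(1,2) finite_subset by (auto simp: finite_simple_graph_def induced_subgraph_def)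
  show "MAT_labeling (induced_subgraph G X) lam"
    using assms(3,4) MAT_labeling_cong by blast
qed

theorem theorem5p8:
  fixes G :: "'a graph" and A B :: "'a set"
    and lamA lamB lamAB lam :: "'a set \<Rightarrow> nat"
  assumes "finite_simple_graph G"
    and "verts G = A \<union> B"
    and "edges G = edges (induced_subgraph G A) \<union> edges (induced_subgraph G B)"
    and "clique (A \<inter> B) (edges G)"
    and "MAT_labeling (induced_subgraph G A) lamA"
    and "MAT_labeling (induced_subgraph G B) lamB"
    and "MAT_labeling (induced_subgraph G (A \<inter> B)) lamAB"
    and "\<forall>e\<in>edges (induced_subgraph G (A \<inter> B)). lamA e = lamAB e"
    and "\<forall>e\<in>edges (induced_subgraph G (A \<inter> B)). lamB e = lamAB e"
    and "\<forall>e\<in>edges (induced_subgraph G A). lam e = lamA e"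
    and "\<forall>e\<in>edges (induced_subgraph G B). lam e = lamB e"
  shows "MAT_labeling G lam"
proof -
  have "lamAB e = lam e" if "e \<in> edges (induced_subgraph G (A \<inter> B))" for e
  proof -
    have "e \<in> edges (induced_subgraph G A)"
      using that by (auto simp: induced_subgraph_def)
    then show ?thesis
      using that assms(8,10) by simp
  qed
  then have C: "MAT_graph (induced_subgraph G (A \<inter> B)) lam"
    using assms(2) by (intro MAT_graph_induced_subgraph[OF assms(1) _ assms(7)]) auto
  have A: "MAT_graph (induced_subgraph G A) lam"
    using assms(2,10) by (intro MAT_graph_induced_subgraph[OF assms(1) _ assms(5)]) simp_all
  have B: "MAT_graph (induced_subgraph G B) lam"
    using assms(2,11) by (intro MAT_graph_induced_subgraph[OF assms(1) _ assms(6)]) simp_all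
  have "\<forall>e\<in>edges G. e \<subseteq> A \<or> e \<subseteq> B"
    using assms(3) unfolding induced_subgraph_def by force
  then have "MAT_gluing G A B lam"
    using assms(2,4) A B C by (intro MAT_gluing.intro)
  then show ?thesis
    by (rule MAT_gluing.MAT_labeling_glue)
qed

end
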